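(* Let $G$ be a finite abelian group and let $S$ be a nonempty subset of the dual group $\widehat{G}$. Given a function $f: G \to \mathbb{R}$ and a Hermitian matrix $Q \in \mathbb{C}^{S \times S}$, we have \[ \min_{g \in G} f(g) \ge -\|\widehat{e}\|_1 + \lambda |S|, \] where $\lambda$ is the minimal eigenvalue of $Q$, $v_S = (\chi)_{\chi \in S}$ is the column vector consisting of all characters in $S$, and $e = f - v_S^* Q v_S$.
   Context: For a finite abelian group $G$, the dual group $\widehat{G}$ is the group of all characters of $G$, i.e. group homomorphisms $\chi: G \to \mathbb{C}^\times$. Every function $h: G \to \mathbb{C}$ has a Fourier expansion $h = \sum_{\chi \in \widehat{G}} \widehat{h}(\chi)\chi$ with Fourier coefficients $\widehat{h}(\chi) = \frac{1}{|G|}\sum_{g \in G} h(g)\overline{\chi(g)}$. We write $\|\widehat{h}\|_1 = \sum_{\chi \in \widehat{G}} |\widehat{h}(\chi)|$. The notation $Q \in \mathbb{C}^{S\times S}$ means that $Q$ is a complex matrix of size $|S|$ whose rows and columns are indexed by elements of $S$. For $g \in G$, $v_S(g) = (\chi(g))_{\chi \in S}$, $v_S(g)^*$ is its conjugate transpose, and $v_S^* Q v_S$ denotes the function $g \mapsto v_S(g)^* Q\, v_S(g) = \sum_{\chi,\chi' \in S} \overline{\chi(g)}\, Q_{\chi,\chi'}\, \chi'(g)$ on $G$. *)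

theory Defs
  imports
    "HOL-Algebra.Algebraic_Closure_Type"
    "Jordan_Normal_Form.Char_Poly"
    Complex_Main
begin

text \<open>
  The underlying set of the dual group of \<open>G\<close>. Characters are normalised to be \<open>undefined\<close>
  outside the carrier, so that two characters are equal as HOL functions iff they agree on \<open>G\<close>;
  without this, each character would be counted once per extension to the whole type.
\<close>

definition characters :: "('a, 'm) monoid_scheme \<Rightarrow> ('a \<Rightarrow> complex) set" where
  "characters G =
     hom G (units_of (ring_of_type_algebra :: complex ring)) \<inter> extensional (carrier G)"

lemma characters_iff:
  "\<chi> \<in> characters G \<longleftrightarrow>
     \<chi> \<in> extensional (carrier G) \<and> (\<forall>x\<in>carrier G. \<chi> x \<noteq> 0) \<and>
     (\<forall>x\<in>carrier G. \<forall>y\<in>carrier G. \<chi> (x \<otimes>\<^bsub>G\<^esub> y) = \<chi> x * \<chi> y)"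
proof -
  have "Units (ring_of_type_algebra :: complex ring) = - {0}"
  proof (intro equalityI subsetI)
    fix z :: complex assume "z \<in> - {0}"
    then have "inverse z * z = 1 \<and> z * inverse z = 1" by simp
    then show "z \<in> Units (ring_of_type_algebra :: complex ring)"
      unfolding Units_def ring_of_type_algebra_def by auto
  qed (auto simp: Units_def ring_of_type_algebra_def)
  then show ?thesis
    by (auto simp: characters_def hom_def units_of_def ring_of_type_algebra_def)
qed

definition fourier_coeff ::
    "('a, 'm) monoid_scheme \<Rightarrow> ('a \<Rightarrow> complex) \<Rightarrow> ('a \<Rightarrow> complex) \<Rightarrow> complex" where
  "fourier_coeff G h \<chi> = (\<Sum>g\<in>carrier G. h g * cnj (\<chi> g)) / of_nat (card (carrier G))"

definition fourier_l1_norm :: "('a, 'm) monoid_scheme \<Rightarrow> ('a \<Rightarrow> complex) \<Rightarrow> real" where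
  "fourier_l1_norm G h = (\<Sum>\<chi>\<in>characters G. cmod (fourier_coeff G h \<chi>))"

text \<open>
  A matrix with rows and columns indexed by a finite set \<open>S\<close> is a function
  \<open>Q :: 'i \<Rightarrow> 'i \<Rightarrow> complex\<close> of which only the entries in \<open>S \<times> S\<close> matter.
\<close>

definition hermitian_on :: "'i set \<Rightarrow> ('i \<Rightarrow> 'i \<Rightarrow> complex) \<Rightarrow> bool" where
  "hermitian_on S Q \<longleftrightarrow> (\<forall>i\<in>S. \<forall>j\<in>S. Q i j = cnj (Q j i))"

definition eigenvalue_on :: "'i set \<Rightarrow> ('i \<Rightarrow> 'i \<Rightarrow> complex) \<Rightarrow> complex \<Rightarrow> bool" where
  "eigenvalue_on S Q k \<longleftrightarrow>
     (\<exists>x. (\<exists>i\<in>S. x i \<noteq> 0) \<and> (\<forall>i\<in>S. (\<Sum>j\<in>S. Q i j * x j) = k * x i))"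

text \<open>Agreement with the library's notion, for any enumeration of the index set:\<close>

lemma eigenvalue_on_iff_eigenvalue:
  assumes "distinct is" and "set is = S"
  shows "eigenvalue_on S Q k \<longleftrightarrow>
    eigenvalue (mat (length is) (length is) (\<lambda>(a, b). Q (is ! a) (is ! b))) k"
    (is "_ \<longleftrightarrow> eigenvalue ?A k")
proof
  let ?n = "length is"
  have bij: "bij_betw ((!) is) {0..<?n} S"
    using assms bij_betw_nth[of "is" "{0..<?n}" S] by (simp add: atLeast0LessThan)
  have sum: "(\<Sum>j\<in>S. f j) = (\<Sum>b\<in>{0..<?n}. f (is ! b))" for f :: "_ \<Rightarrow> complex"
    using sum.reindex_bij_betw[OF bij, of f] by simp
  have S: "S = {is ! a |a. a < ?n}"
    using assms(2) by (auto simp: set_conv_nth)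
  {
    assume "eigenvalue_on S Q k"
    then obtain x where x: "\<exists>i\<in>S. x i \<noteq> 0" "\<forall>i\<in>S. (\<Sum>j\<in>S. Q i j * x j) = k * x i"
      unfolding eigenvalue_on_def by blast
    define v where "v = vec ?n (\<lambda>a. x (is ! a))"
    obtain a where a: "a < ?n" "x (is ! a) \<noteq> 0" using x(1) S by auto
    then have "v $ a \<noteq> 0\<^sub>v ?n $ a" by (simp add: v_def)
    then have "v \<noteq> 0\<^sub>v ?n" by auto
    moreover have "(\<Sum>b\<in>{0..<?n}. Q (is ! a) (is ! b) * x (is ! b)) = k * x (is ! a)"
      if "a < ?n" for a
      using x(2) S that by (subst sum[symmetric]) blast
    then have "?A *\<^sub>v v = k \<cdot>\<^sub>v v"
      by (intro eq_vecI) (auto simp: v_def scalar_prod_def)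
    ultimately show "eigenvalue ?A k"
      unfolding eigenvalue_def eigenvector_def by (auto intro!: exI[of _ v] simp: v_def)
  }
  {
    assume "eigenvalue ?A k"
    then obtain v where v: "v \<in> carrier_vec ?n" "v \<noteq> 0\<^sub>v ?n" "?A *\<^sub>v v = k \<cdot>\<^sub>v v"
      unfolding eigenvalue_def eigenvector_def by auto
    define x where "x i = v $ (the_inv_into {0..<?n} ((!) is) i)" for i
    have xv: "x (is ! a) = v $ a" if "a < ?n" for a
      using that bij by (simp add: x_def bij_betw_def the_inv_into_f_f)
    have "\<exists>a<?n. v $ a \<noteq> 0"
    proof (rule ccontr)
      assume "\<not> ?thesis"
      then have "v = 0\<^sub>v ?n" using v(1) by (intro eq_vecI) auto
      with v(2) show False by simp
    qed
    then have "\<exists>i\<in>S. x i \<noteq> 0" using S xv by fastforce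
    moreover have "(\<Sum>j\<in>S. Q (is ! a) j * x j) = k * x (is ! a)" if "a < ?n" for a
    proof -
      have "(?A *\<^sub>v v) $ a = (\<Sum>b\<in>{0..<?n}. Q (is ! a) (is ! b) * v $ b)"
        using that v(1) by (simp add: scalar_prod_def)
      then show ?thesis using v that by (simp add: sum xv)
    qed
    ultimately show "eigenvalue_on S Q k"
      unfolding eigenvalue_on_def using S by (intro exI[of _ x]) auto
  }
qed

text \<open>
  Intended for Hermitian matrices with nonempty index set: these have at least one eigenvalue,
  and all of their eigenvalues are real.
\<close>

definition min_eigenvalue :: "'i set \<Rightarrow> ('i \<Rightarrow> 'i \<Rightarrow> complex) \<Rightarrow> real" where
  "min_eigenvalue S Q = Min {x. eigenvalue_on S Q (complex_of_real x)}"

text \<open>The function \<open>v\<^sub>S\<^sup>* Q v\<^sub>S\<close>, where \<open>v\<^sub>S(g) = (\<chi>(g))\<^sub>\<chi>\<close> with \<open>\<chi>\<close> ranging over \<open>S\<close>.\<close>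

definition quad_form ::
    "('a \<Rightarrow> complex) set \<Rightarrow> (('a \<Rightarrow> complex) \<Rightarrow> ('a \<Rightarrow> complex) \<Rightarrow> complex) \<Rightarrow> 'a \<Rightarrow> complex" where
  "quad_form S Q g = (\<Sum>\<chi>\<in>S. \<Sum>\<chi>'\<in>S. cnj (\<chi> g) * Q \<chi> \<chi>' * \<chi>' g)"

end

theory Submission
  imports Defs "HOL-Analysis.Function_Topology" "HOL-Analysis.Complex_Transcendental"
begin

unbundle no vec_syntax  \<comment> \<open>it makes \<open>\<chi>\<close> a binder\<close>

text \<open>
  Pointwise, \<open>f(g) = e(g) + v(g)\<^sup>* Q v(g)\<close>. Fourier inversion and \<open>\<bar>\<chi>(g)\<bar> = 1\<close> bound \<open>\<bar>e(g)\<bar>\<close>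
  by the \<open>\<ell>\<^sub>1\<close>-norm of the Fourier transform of \<open>e\<close>, and the Rayleigh quotient bound gives
  \<open>v(g)\<^sup>* Q v(g) \<ge> \<lambda> \<parallel>v(g)\<parallel>\<^sup>2 = \<lambda> \<bar>S\<bar>\<close>. Inversion rests on characters separating points, which
  follows by extending characters from a subgroup one generator at a time. The Rayleigh bound holds
  because a minimiser of the quotient on the unit sphere is an eigenvector.
\<close>

section \<open>Characters of finite abelian groups\<close>

lemma (in group) character_one:
  assumes "\<chi> \<in> characters G"
  shows "\<chi> \<one> = 1"
proof -
  have "\<chi> \<one> * \<chi> \<one> = \<chi> \<one>" "\<chi> \<one> \<noteq> 0"
    using assms unfolding characters_iff by (metis one_closed l_one)+
  then show ?thesis by simp
qed

lemma character_mult: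
  assumes "\<chi> \<in> characters G" "x \<in> carrier G" "y \<in> carrier G"
  shows "\<chi> (x \<otimes>\<^bsub>G\<^esub> y) = \<chi> x * \<chi> y"
  using assms by (simp add: characters_iff)

lemma (in group) character_pow:
  assumes "\<chi> \<in> characters G" "x \<in> carrier G"
  shows "\<chi> (x [^] (k::nat)) = \<chi> x ^ k"
  by (induction k) (use assms in \<open>auto simp: character_one character_mult\<close>)

lemma (in group) character_pow_order:
  assumes "\<chi> \<in> characters G" "x \<in> carrier G"
  shows "\<chi> x ^ Coset.order G = 1"
  using assms by (metis character_pow pow_order_eq_1 character_one)

text \<open>Character values are roots of unity, so the modulus is a nonnegative real with a
  positive power equal to 1.\<close>

lemma (in group) norm_character:
  assumes "finite (carrier G)" "\<chi> \<in> characters G" "x \<in> carrier G"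
  shows "cmod (\<chi> x) = 1"
proof -
  have "Coset.order G > 0" using assms(1) by (simp add: order_gt_0_iff_finite)
  moreover have "cmod (\<chi> x) ^ Coset.order G = 1"
    using character_pow_order[OF assms(2,3)] by (metis norm_power norm_one)
  ultimately show ?thesis
    by (metis norm_ge_zero power_eq_imp_eq_base power_one zero_le_one)
qed

text \<open>Both sides are the multiplicative inverse of \<open>\<chi> x\<close>: one by
  multiplicativity, the other because \<open>\<chi> x\<close> has modulus 1.\<close>

lemma (in group) character_inv:
  assumes "finite (carrier G)" "\<chi> \<in> characters G" "x \<in> carrier G"
  shows "\<chi> (inv x) = cnj (\<chi> x)"
proof -
  have "\<chi> x * \<chi> (inv x) = 1"
    using assms by (metis character_mult character_one inv_closed r_inv)
  moreover have "\<chi> x * cnj (\<chi> x) = 1"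
    using norm_character[OF assms] by (simp add: complex_norm_square[symmetric])
  ultimately show ?thesis
    by (metis mult_cancel_left mult_zero_left zero_neq_one)
qed

text \<open>Values are roots of unity whose order divides the group order, and extensionality fixes
  the values off the carrier, so only finitely many functions remain.\<close>

lemma (in group) finite_characters:
  assumes "finite (carrier G)"
  shows "finite (characters G)"
proof (rule finite_subset)
  have "Coset.order G > 0" using assms by (simp add: order_gt_0_iff_finite)
  then show "finite (carrier G \<rightarrow>\<^sub>E {z::complex. z ^ Coset.order G = 1})"
    using assms finite_roots_unity[of "Coset.order G"] by (intro finite_PiE) auto
  show "characters G \<subseteq> carrier G \<rightarrow>\<^sub>E {z. z ^ Coset.order G = 1}"
    using character_pow_order by (auto simp: PiE_def characters_iff)
qed

section \<open>Extending characters from subgroups\<close>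

text \<open>Here \<open>m\<close> is the order of \<open>a\<close> modulo \<open>H\<close>. It is
  taken as the least positive exponent with power in \<open>H\<close>; a nonzero remainder modulo
  \<open>m\<close> would give a smaller one.\<close>

lemma (in group) nat_pow_mem_iff_dvd:
  assumes "finite (carrier G)" "subgroup H G" "a \<in> carrier G"
  obtains m :: nat where "m > 0" "\<And>k. a [^] k \<in> H \<longleftrightarrow> m dvd k"
proof -
  interpret H: subgroup H G by fact
  define m where "m = (LEAST k::nat. k > 0 \<and> a [^] k \<in> H)"
  have "Coset.order G > 0 \<and> a [^] Coset.order G \<in> H"
    using assms by (simp add: order_gt_0_iff_finite pow_order_eq_1)
  then have m: "m > 0 \<and> a [^] m \<in> H"
    unfolding m_def by (rule LeastI)
  have mult: "a [^] (m * q) \<in> H" for q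
    by (induction q) (use m assms in \<open>auto simp: nat_pow_mult[symmetric]\<close>)
  have "m dvd k" if k: "a [^] k \<in> H" for k
  proof (rule ccontr)
    assume "\<not> m dvd k"
    then have r: "0 < k mod m" "k mod m < m" using m by (auto simp: dvd_eq_mod_eq_0)
    have "a [^] k = a [^] (m * (k div m)) \<otimes> a [^] (k mod m)"
      using assms by (simp add: nat_pow_mult)
    then have "a [^] (k mod m) = inv (a [^] (m * (k div m))) \<otimes> a [^] k"
      using assms by (simp add: m_assoc[symmetric])
    also have "\<dots> \<in> H"
      using k mult by blast
    finally show False
      using r not_less_Least[of "k mod m" "\<lambda>k. k > 0 \<and> a [^] k \<in> H"] by (simp add: m_def)
  qed
  then show ?thesis
    using that m mult by (metis dvdE)
qed

text \<open>The extension to the subgroup generated by \<open>H\<close> and \<open>a\<close> sends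
  \<open>h \<otimes> a [^] k\<close> to \<open>\<chi> h * z ^ k\<close>. The condition on
  \<open>z ^ m\<close> is the compatibility that makes this well defined. Any such root
  \<open>z\<close> may be prescribed, which is what allows points to be separated later.\<close>

lemma (in comm_group) character_extend_step:
  assumes fin: "finite (carrier G)" and H: "subgroup H G"
    and \<chi>: "\<chi> \<in> characters (G\<lparr>carrier := H\<rparr>)" and a: "a \<in> carrier G"
    and dvd: "\<And>k. a [^] (k::nat) \<in> H \<longleftrightarrow> m dvd k"
    and z: "z \<noteq> 0" "z ^ m = \<chi> (a [^] m)"
  obtains H' \<chi>' where "subgroup H' G" "H \<subseteq> H'" "a \<in> H'"
    "\<chi>' \<in> characters (G\<lparr>carrier := H'\<rparr>)" "\<And>x. x \<in> H \<Longrightarrow> \<chi>' x = \<chi> x" "\<chi>' a = z"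
proof -
  interpret H: subgroup H G by fact
  interpret HG: group "G\<lparr>carrier := H\<rparr>" using H by (rule subgroup_imp_group)
  have Hc: "x \<in> carrier G" if "x \<in> H" for x using that by (rule H.mem_carrier)
  have \<chi>m: "\<chi> (x \<otimes> y) = \<chi> x * \<chi> y" if "x \<in> H" "y \<in> H" for x y
    using character_mult[OF \<chi>] that by simp
  have \<chi>1: "\<chi> \<one> = 1" using HG.character_one[OF \<chi>] by simp
  have \<chi>0: "\<chi> x \<noteq> 0" if "x \<in> H" for x
    using \<chi> that by (simp add: characters_iff)
  have am: "a [^] m \<in> H" using dvd by simp
  have power: "\<chi> (a [^] k) = z ^ k" if k: "a [^] k \<in> H" for k :: nat
  proof -
    obtain q where q: "k = m * q" using k dvd by blast
    have "\<chi> ((a [^] m) [^] q) = \<chi> (a [^] m) ^ q"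
      using HG.character_pow[OF \<chi>, of "a [^] m" q] am by (simp add: nat_pow_consistent[symmetric])
    then show ?thesis using a by (simp add: q nat_pow_pow z power_mult)
  qed
  \<comment> \<open>Cancelling \<open>a [^] k\<close> puts \<open>a [^] (l - k)\<close> into
    \<open>H\<close>, where \<open>power\<close> evaluates \<open>\<chi>\<close>. The other order of
    exponents follows by symmetry.\<close>
  have le: "\<chi> h * z ^ k = \<chi> h' * z ^ l"
    if h: "h \<in> H" "h' \<in> H" and eq: "h \<otimes> a [^] k = h' \<otimes> a [^] l" and "k \<le> l"
    for h h' and k l :: nat
  proof -
    have "h \<otimes> a [^] k = (h' \<otimes> a [^] (l - k)) \<otimes> a [^] k"
      using eq \<open>k \<le> l\<close> h Hc a by (simp add: m_assoc nat_pow_mult)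
    then have 1: "h = h' \<otimes> a [^] (l - k)"
      using h Hc a by simp
    then have "a [^] (l - k) = inv h' \<otimes> h"
      using h Hc a by (simp add: m_assoc[symmetric])
    then have "a [^] (l - k) \<in> H" using h by simp
    then have "\<chi> h = \<chi> h' * z ^ (l - k)"
      using 1 \<chi>m power h by metis
    then show ?thesis using \<open>k \<le> l\<close> by (simp add: power_add[symmetric])
  qed
  have wd: "\<chi> h * z ^ k = \<chi> h' * z ^ l"
    if "h \<in> H" "h' \<in> H" "h \<otimes> a [^] k = h' \<otimes> a [^] l" for h h' and k l :: nat
    using le[of h h' k l] le[of h' h l k] that by (cases "k \<le> l") auto
  \<comment> \<open>Natural exponents suffice: in a finite group inverses of powers of
    \<open>a\<close> are again such powers.\<close>
  define H' where "H' = {h \<otimes> a [^] (k::nat) | h k. h \<in> H}"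
  \<comment> \<open>The described value is the same for all representations of \<open>x\<close>, by
    \<open>wd\<close>; the restriction makes the function extensional.\<close>
  define \<chi>' where "\<chi>' = restrict (\<lambda>x. THE w. \<exists>h k. h \<in> H \<and> x = h \<otimes> a [^] (k::nat) \<and> w = \<chi> h * z ^ k) H'"
  have \<chi>': "\<chi>' (h \<otimes> a [^] k) = \<chi> h * z ^ k" if "h \<in> H" for h and k :: nat
  proof -
    have "h \<otimes> a [^] k \<in> H'" using that by (auto simp: H'_def)
    moreover have "(THE w. \<exists>h' l. h' \<in> H \<and> h \<otimes> a [^] k = h' \<otimes> a [^] (l::nat) \<and> w = \<chi> h' * z ^ l)
        = \<chi> h * z ^ k"
    proof (rule the_equality)
      show "\<exists>h' l. h' \<in> H \<and> h \<otimes> a [^] k = h' \<otimes> a [^] (l::nat) \<and> \<chi> h * z ^ k = \<chi> h' * z ^ l"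
        by (intro exI[of _ h] exI[of _ k] conjI refl that)
    next
      fix w assume "\<exists>h' l. h' \<in> H \<and> h \<otimes> a [^] k = h' \<otimes> a [^] (l::nat) \<and> w = \<chi> h' * z ^ l"
      then obtain h' and l :: nat where "h' \<in> H" "h \<otimes> a [^] k = h' \<otimes> a [^] l" "w = \<chi> h' * z ^ l"
        by (elim exE conjE)
      then show "w = \<chi> h * z ^ k" using wd[OF that] by simp
    qed
    ultimately show ?thesis by (simp add: \<chi>'_def)
  qed
  have prod: "(h \<otimes> a [^] k) \<otimes> (h' \<otimes> a [^] l) = (h \<otimes> h') \<otimes> a [^] (k + l)"
    if "h \<in> H" "h' \<in> H" for h h' and k l :: nat
    using that Hc a by (simp add: nat_pow_mult[symmetric] m_ac)
  have HH': "x \<in> H'" if "x \<in> H" for x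
    unfolding H'_def using that Hc by (auto intro!: exI[of _ x] exI[of _ "0::nat"])
  have aH': "a \<in> H'"
    unfolding H'_def using a by (auto intro!: exI[of _ \<one>] exI[of _ "1::nat"])
  have sub: "subgroup H' G"
  proof (rule subgroupI)
    show "H' \<subseteq> carrier G" using a Hc by (auto simp: H'_def)
    show "H' \<noteq> {}" using aH' by auto
    fix x y assume "x \<in> H'" "y \<in> H'"
    then show "x \<otimes> y \<in> H'"
      unfolding H'_def using prod by clarsimp (metis H.m_closed)
  next
    fix x assume "x \<in> H'"
    then obtain h k where x: "x = h \<otimes> a [^] (k::nat)" "h \<in> H" by (auto simp: H'_def)
    \<comment> \<open>Prepares the inverse of \<open>a [^] k\<close>. The truncated subtraction is
      harmless because the order is positive.\<close>
    have "k + k * (Coset.order G - 1) = Coset.order G * k"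
      using fin by (cases "Coset.order G") (auto simp: order_gt_0_iff_finite[symmetric])
    then have "a [^] k \<otimes> a [^] (k * (Coset.order G - 1)) = a [^] (Coset.order G * k)"
      using a by (simp add: nat_pow_mult)
    also have "\<dots> = \<one>"
      using a by (simp add: nat_pow_pow[symmetric] pow_order_eq_1)
    finally have "inv (a [^] k) = a [^] (k * (Coset.order G - 1))"
      using a by (metis inv_equality m_comm nat_pow_closed)
    then have "inv x = inv h \<otimes> a [^] (k * (Coset.order G - 1))"
      using x a Hc by (simp add: inv_mult)
    then show "inv x \<in> H'"
      using x unfolding H'_def by blast
  qed
  have "\<chi>' \<in> characters (G\<lparr>carrier := H'\<rparr>)"
    unfolding characters_iff
  proof (intro conjI ballI)
    show "\<chi>' \<in> extensional (carrier (G\<lparr>carrier := H'\<rparr>))" by (simp add: \<chi>'_def)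
  next
    fix x assume "x \<in> carrier (G\<lparr>carrier := H'\<rparr>)"
    then show "\<chi>' x \<noteq> 0" using \<chi>' \<chi>0 z(1) by (auto simp: H'_def)
  next
    fix x y assume "x \<in> carrier (G\<lparr>carrier := H'\<rparr>)" "y \<in> carrier (G\<lparr>carrier := H'\<rparr>)"
    then show "\<chi>' (x \<otimes>\<^bsub>G\<lparr>carrier := H'\<rparr>\<^esub> y) = \<chi>' x * \<chi>' y"
      by (auto simp: H'_def prod \<chi>' \<chi>m power_add)
  qed
  moreover have "\<chi>' x = \<chi> x" if "x \<in> H" for x
    using \<chi>'[of x 0] that Hc by simp
  moreover have "\<chi>' a = z"
    using \<chi>'[of \<one> 1] a \<chi>1 by simp
  ultimately show ?thesis
    using that[OF sub _ aH'] HH' by blast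
qed

text \<open>Induction on the number of elements outside \<open>H\<close>: adjoining one of them
  strictly enlarges the subgroup, and a root \<open>z\<close> exists since the complex field is
  algebraically closed.\<close>

lemma (in comm_group) character_extend:
  assumes fin: "finite (carrier G)"
    and "subgroup H G" "\<chi> \<in> characters (G\<lparr>carrier := H\<rparr>)"
  obtains \<chi>' where "\<chi>' \<in> characters G" "\<And>x. x \<in> H \<Longrightarrow> \<chi>' x = \<chi> x"
proof -
  have "\<exists>\<chi>'\<in>characters G. \<forall>x\<in>H. \<chi>' x = \<chi> x"
    using assms(2,3)
  proof (induction "card (carrier G) - card H" arbitrary: H \<chi> rule: less_induct)
    case less
    interpret H: subgroup H G by fact
    show ?case
    proof (cases "H = carrier G")
      case True
      then show ?thesis using less.prems by auto
    next
      case False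
      then obtain a where a: "a \<in> carrier G" "a \<notin> H" using H.subset by blast
      obtain m where m: "m > 0" "\<And>k. a [^] (k::nat) \<in> H \<longleftrightarrow> m dvd k"
        using nat_pow_mem_iff_dvd[OF fin less.prems(1) a(1)] by blast
      have "a [^] m \<in> H" using m by simp
      then have "\<chi> (a [^] m) \<noteq> 0" using less.prems(2) by (simp add: characters_iff)
      moreover obtain z where z: "z ^ m = \<chi> (a [^] m)"
        using exists_complex_root[of m] m(1) by (metis less_numeral_extra(3))
      ultimately have "z \<noteq> 0" using m(1) by (auto simp: power_0_left)
      obtain H' \<chi>' where H': "subgroup H' G" "H \<subseteq> H'" "a \<in> H'"
        "\<chi>' \<in> characters (G\<lparr>carrier := H'\<rparr>)" "\<And>x. x \<in> H \<Longrightarrow> \<chi>' x = \<chi> x"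
        using character_extend_step[OF fin less.prems a(1) m(2) \<open>z \<noteq> 0\<close> z] by blast
      have fin': "finite H'" "H' \<subseteq> carrier G"
        using fin H'(1) finite_subset subgroup.subset by blast+
      have "H \<subset> H'" using H'(2,3) a by blast
      then have "card H < card H'" "card H' \<le> card (carrier G)"
        using fin' fin by (auto intro: psubset_card_mono card_mono)
      then show ?thesis
        using less.hyps[of H' \<chi>'] H' by (metis diff_less_mono2 order_less_le_trans subsetD)
    qed
  qed
  then show ?thesis using that by blast
qed

text \<open>Starting from the trivial subgroup, \<open>g\<close> has order \<open>m > 1\<close>, so
  it can be sent to an \<open>m\<close>-th root of unity other than 1. The resulting character then
  extends to all of \<open>G\<close>.\<close>

lemma (in comm_group) character_separates:
  assumes fin: "finite (carrier G)" and g: "g \<in> carrier G" "g \<noteq> \<one>"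
  obtains \<chi> where "\<chi> \<in> characters G" "\<chi> g \<noteq> 1"
proof -
  have sub: "subgroup {\<one>} G" by (rule triv_subgroup)
  define \<chi> :: "'a \<Rightarrow> complex" where "\<chi> = restrict (\<lambda>_. 1) {\<one>}"
  have \<chi>: "\<chi> \<in> characters (G\<lparr>carrier := {\<one>}\<rparr>)"
    by (simp add: characters_iff \<chi>_def)
  obtain m where m: "m > 0" "\<And>k. g [^] (k::nat) \<in> {\<one>} \<longleftrightarrow> m dvd k"
    using nat_pow_mem_iff_dvd[OF fin sub g(1)] by blast
  have "g [^] (1::nat) \<notin> {\<one>}" using g by simp
  then have "m \<noteq> 1" using m(2)[of 1] by auto
  then have "card {z::complex. z ^ m = 1} > 1"
    using m(1) by (simp add: card_roots_unity_eq)
  then have "\<not> {z::complex. z ^ m = 1} \<subseteq> {1}"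
    using card_mono[of "{1::complex}" "{z. z ^ m = 1}"] by auto
  then obtain z :: complex where z: "z ^ m = 1" "z \<noteq> 1" by blast
  have "g [^] m = \<one>" using m(2)[of m] by simp
  then have z': "z ^ m = \<chi> (g [^] m)" using z by (simp add: \<chi>_def)
  have "z \<noteq> 0" using z m(1) by (metis power_0_left zero_neq_one less_numeral_extra(3))
  from character_extend_step[OF fin sub \<chi> g(1) m(2) this z']
  obtain H' \<chi>' where H': "subgroup H' G" "g \<in> H'" "\<chi>' \<in> characters (G\<lparr>carrier := H'\<rparr>)" "\<chi>' g = z"
    by blast
  from character_extend[OF fin H'(1,3)] obtain \<chi>'' where
    "\<chi>'' \<in> characters G" "\<And>x. x \<in> H' \<Longrightarrow> \<chi>'' x = \<chi>' x" by blast
  then show ?thesis using that H' z by metis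
qed

section \<open>Fourier inversion\<close>

text \<open>Translation by \<open>a\<close> permutes the group and multiplies the sum by
  \<open>\<chi> a\<close>, which differs from 1.\<close>

lemma (in group) sum_character:
  assumes fin: "finite (carrier G)" and \<chi>: "\<chi> \<in> characters G" and a: "a \<in> carrier G" "\<chi> a \<noteq> 1"
  shows "(\<Sum>g\<in>carrier G. \<chi> g) = 0"
proof -
  have "(\<Sum>g\<in>carrier G. \<chi> g) = (\<Sum>g\<in>carrier G. \<chi> (a \<otimes> g))"
    using sum.reindex[OF inj_on_cmult[OF a(1)], of \<chi>] surj_const_mult[OF a(1)] by simp
  also have "\<dots> = \<chi> a * (\<Sum>g\<in>carrier G. \<chi> g)"
    using a \<chi> by (simp add: sum_distrib_left character_mult)
  finally show ?thesis using a(2) by auto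
qed

text \<open>Dual to the previous argument: multiplication by a character \<open>\<psi>\<close> with
  \<open>\<psi> g \<noteq> 1\<close> permutes the characters.\<close>

lemma (in comm_group) sum_characters_eq_0:
  assumes fin: "finite (carrier G)" and g: "g \<in> carrier G" "g \<noteq> \<one>"
  shows "(\<Sum>\<chi>\<in>characters G. \<chi> g) = 0"
proof -
  obtain \<psi> where \<psi>: "\<psi> \<in> characters G" "\<psi> g \<noteq> 1"
    using character_separates[OF assms] .
  have \<psi>0: "\<psi> x \<noteq> 0" if "x \<in> carrier G" for x
    using \<psi>(1) that by (simp add: characters_iff)
  have "(\<Sum>\<chi>\<in>characters G. \<chi> g) = (\<Sum>\<chi>\<in>characters G. \<psi> g * \<chi> g)"
  \<comment> \<open>Pointwise products and quotients are restricted to the carrier so that they stay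
    extensional.\<close>
  proof (rule sum.reindex_bij_witness[where
        i = "\<lambda>\<chi>. restrict (\<lambda>x. \<psi> x * \<chi> x) (carrier G)" and
        j = "\<lambda>\<chi>. restrict (\<lambda>x. \<chi> x / \<psi> x) (carrier G)"])
    fix \<chi> assume "\<chi> \<in> characters G"
    then show "restrict (\<lambda>x. \<psi> x * restrict (\<lambda>x. \<chi> x / \<psi> x) (carrier G) x) (carrier G) = \<chi>"
      "restrict (\<lambda>x. restrict (\<lambda>x. \<psi> x * \<chi> x) (carrier G) x / \<psi> x) (carrier G) = \<chi>"
      "restrict (\<lambda>x. \<psi> x * \<chi> x) (carrier G) \<in> characters G"
      "restrict (\<lambda>x. \<chi> x / \<psi> x) (carrier G) \<in> characters G"
      using \<psi>(1) \<psi>0 by (auto simp: characters_iff extensional_def fun_eq_iff restrict_def)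
  qed (use \<psi>0 g in auto)
  also have "\<dots> = \<psi> g * (\<Sum>\<chi>\<in>characters G. \<chi> g)"
    by (simp add: sum_distrib_left)
  finally show ?thesis using \<psi>(2) by auto
qed

text \<open>Double counting of the sum of all \<open>\<chi> g\<close>: summed over \<open>g\<close>
  first, only the trivial character \<open>?\<epsilon>\<close> contributes; summed over
  \<open>\<chi>\<close> first, only the identity does.\<close>

lemma (in comm_group) card_characters:
  assumes fin: "finite (carrier G)"
  shows "card (characters G) = Coset.order G"
proof -
  let ?\<epsilon> = "restrict (\<lambda>_. 1) (carrier G) :: 'a \<Rightarrow> complex"
  have \<epsilon>: "?\<epsilon> \<in> characters G" by (simp add: characters_iff)
  have "(\<Sum>g\<in>carrier G. \<chi> g) = (if \<chi> = ?\<epsilon> then of_nat (Coset.order G) else 0)"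
    if \<chi>: "\<chi> \<in> characters G" for \<chi>
  proof (cases "\<chi> = ?\<epsilon>")
    case True
    then show ?thesis by (simp add: Coset.order_def)
  next
    case False
    moreover have "\<chi> = ?\<epsilon>" if "\<forall>a\<in>carrier G. \<chi> a = 1"
      using \<chi> that by (intro extensionalityI[of _ "carrier G"]) (simp_all add: characters_iff)
    ultimately obtain a where "a \<in> carrier G" "\<chi> a \<noteq> 1" by blast
    then show ?thesis using sum_character[OF fin \<chi>] False by simp
  qed
  then have "(\<Sum>\<chi>\<in>characters G. \<Sum>g\<in>carrier G. \<chi> g) = of_nat (Coset.order G)"
    using \<epsilon> finite_characters[OF fin] by simp
  moreover have "(\<Sum>\<chi>\<in>characters G. \<Sum>g\<in>carrier G. \<chi> g) = of_nat (card (characters G))"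
  proof -
    have "(\<Sum>\<chi>\<in>characters G. \<Sum>g\<in>carrier G. \<chi> g) = (\<Sum>g\<in>carrier G. \<Sum>\<chi>\<in>characters G. \<chi> g)"
      by (rule sum.swap)
    also have "\<dots> = (\<Sum>g\<in>carrier G. if g = \<one> then of_nat (card (characters G)) else 0)"
      by (rule sum.cong) (auto simp: sum_characters_eq_0[OF fin] character_one)
    finally show ?thesis using fin by simp
  qed
  ultimately show ?thesis by (metis of_nat_eq_iff)
qed

lemma (in comm_group) fourier_inversion:
  assumes fin: "finite (carrier G)" and x: "x \<in> carrier G"
  shows "h x = (\<Sum>\<chi>\<in>characters G. fourier_coeff G h \<chi> * \<chi> x)"
proof -
  have pos: "Coset.order G > 0" using fin by (simp add: order_gt_0_iff_finite)
  \<comment> \<open>Column orthogonality: each summand is \<open>\<chi> (inv g \<otimes> x)\<close>,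
    and for \<open>g = x\<close> the sum counts the characters.\<close>
  have orth: "(\<Sum>\<chi>\<in>characters G. cnj (\<chi> g) * \<chi> x) = (if g = x then of_nat (Coset.order G) else 0)"
    if g: "g \<in> carrier G" for g
  proof -
    have "(\<Sum>\<chi>\<in>characters G. cnj (\<chi> g) * \<chi> x) = (\<Sum>\<chi>\<in>characters G. \<chi> (inv g \<otimes> x))"
      using g x by (intro sum.cong) (auto simp: character_mult character_inv[OF fin])
    moreover have "inv g \<otimes> x = \<one> \<longleftrightarrow> g = x"
      using g x by (metis inv_closed inv_equality inv_inv l_inv)
    ultimately show ?thesis
      using g x sum_characters_eq_0[OF fin, of "inv g \<otimes> x"]
      by (auto simp: character_one card_characters[OF fin])
  qed
  have "(\<Sum>\<chi>\<in>characters G. fourier_coeff G h \<chi> * \<chi> x)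
      = (\<Sum>\<chi>\<in>characters G. \<Sum>g\<in>carrier G. h g * (cnj (\<chi> g) * \<chi> x)) / of_nat (Coset.order G)"
    by (simp add: fourier_coeff_def Coset.order_def sum_divide_distrib sum_distrib_right mult.assoc)
  also have "\<dots> = (\<Sum>g\<in>carrier G. h g * (\<Sum>\<chi>\<in>characters G. cnj (\<chi> g) * \<chi> x)) / of_nat (Coset.order G)"
    by (subst sum.swap) (simp add: sum_distrib_left)
  also have "(\<Sum>g\<in>carrier G. h g * (\<Sum>\<chi>\<in>characters G. cnj (\<chi> g) * \<chi> x))
      = (\<Sum>g\<in>carrier G. if g = x then h x * of_nat (Coset.order G) else 0)"
    by (rule sum.cong) (auto simp: orth)
  also have "\<dots> / of_nat (Coset.order G) = h x"
    using fin x pos by simp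
  finally show ?thesis ..
qed

text \<open>Triangle inequality in the inversion formula, with all \<open>\<chi> x\<close> of
  modulus 1.\<close>

lemma (in comm_group) norm_le_fourier_l1_norm:
  assumes fin: "finite (carrier G)" and x: "x \<in> carrier G"
  shows "cmod (h x) \<le> fourier_l1_norm G h"
proof -
  have "cmod (h x) \<le> (\<Sum>\<chi>\<in>characters G. cmod (fourier_coeff G h \<chi> * \<chi> x))"
    unfolding fourier_inversion[OF assms, of h] by (rule norm_sum)
  also have "\<dots> = fourier_l1_norm G h"
    unfolding fourier_l1_norm_def using norm_character[OF fin _ x]
    by (intro sum.cong) (auto simp: norm_mult)
  finally show ?thesis .
qed

section \<open>The least eigenvalue of a Hermitian matrix\<close>

text \<open>Eigenvalues are roots of the characteristic polynomial, which is monic and hence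
  nonzero. This makes the \<open>Min\<close> in \<open>min_eigenvalue\<close> range over a finite
  set.\<close>

lemma finite_eigenvalues_on:
  assumes "finite S"
  shows "finite {k. eigenvalue_on S Q k}"
proof -
  obtain xs where xs: "distinct xs" "set xs = S"
    using finite_distinct_list[OF assms] by blast
  let ?A = "Matrix.mat (length xs) (length xs) (\<lambda>(a, b). Q (xs ! a) (xs ! b))"
  have A: "?A \<in> carrier_mat (length xs) (length xs)" by simp
  then have "char_poly ?A \<noteq> 0"
    using degree_monic_char_poly[OF A] by auto
  then show ?thesis
    using poly_roots_finite[of "char_poly ?A"]
    by (simp add: eigenvalue_on_iff_eigenvalue[OF xs] eigenvalue_root_char_poly[OF A])
qed

text \<open>Take \<open>\<mu>\<close> to be the minimum of the form on the unit sphere. Homogeneity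
  turns minimality into the bound for all \<open>x\<close>; vanishing of the first variation makes
  the minimiser an eigenvector.\<close>

lemma hermitian_rayleigh_bound:
  assumes fin: "finite S" and ne: "S \<noteq> {}" and herm: "hermitian_on S Q"
  shows "\<exists>\<mu>::real. eigenvalue_on S Q (of_real \<mu>) \<and>
    (\<forall>x. \<mu> * (\<Sum>i\<in>S. (cmod (x i))\<^sup>2) \<le> Re (\<Sum>i\<in>S. \<Sum>j\<in>S. cnj (x i) * Q i j * x j))"
proof -
  define F where "F x = Re (\<Sum>i\<in>S. \<Sum>j\<in>S. cnj (x i) * Q i j * x j)" for x
  define N where "N x = (\<Sum>i\<in>S. (cmod (x i))\<^sup>2)" for x :: "'a \<Rightarrow> complex"
  \<comment> \<open>Vectors are functions on a possibly infinite type; forcing zero outside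
    \<open>S\<close> makes \<open>B\<close> a product of compact sets, so Tychonoff applies.\<close>
  define B where "B = (\<Pi>\<^sub>E i\<in>UNIV. if i \<in> S then cball (0::complex) 1 else {0})"
  define K where "K = B \<inter> {x. N x = 1}"
  have coord: "continuous_on UNIV (\<lambda>x::'a \<Rightarrow> complex. x i)" for i
    by (rule continuous_on_product_coordinates)
  have "compact B"
    using compactin_PiE[of "\<lambda>_. euclidean" UNIV "\<lambda>i. if i \<in> S then cball (0::complex) 1 else {0}"]
    by (simp add: euclidean_product_topology B_def)
  moreover have "closed {x. N x = 1}"
    unfolding N_def by (intro closed_Collect_eq continuous_intros coord)
  ultimately have "compact K" unfolding K_def by (rule compact_Int_closed)
  moreover have "K \<noteq> {}"
  proof -
    obtain s where s: "s \<in> S" using ne by blast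
    have "N (\<lambda>i. if i = s then 1 else 0) = (\<Sum>i\<in>S. if i = s then 1 else 0)"
      unfolding N_def by (rule sum.cong) auto
    then have "(\<lambda>i. if i = s then 1 else 0) \<in> K"
      using fin s by (auto simp: K_def B_def)
    then show ?thesis by blast
  qed
  moreover have "continuous_on K F"
    unfolding F_def
    by (intro continuous_intros continuous_on_subset[OF coord]) auto
  ultimately obtain x where x: "x \<in> K" "\<And>y. y \<in> K \<Longrightarrow> F x \<le> F y"
    using continuous_attains_inf by metis
  define \<mu> where "\<mu> = F x"
  have scale: "F (\<lambda>i. of_real c * y i) = c\<^sup>2 * F y" "N (\<lambda>i. of_real c * y i) = c\<^sup>2 * N y"
    for c :: real and y
  proof -
    have "(\<Sum>i\<in>S. \<Sum>j\<in>S. cnj (of_real c * y i) * Q i j * (of_real c * y j))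
       = of_real (c\<^sup>2) * (\<Sum>i\<in>S. \<Sum>j\<in>S. cnj (y i) * Q i j * y j)"
      by (simp add: sum_distrib_left power2_eq_square mult_ac)
    then show "F (\<lambda>i. of_real c * y i) = c\<^sup>2 * F y"
      unfolding F_def by (simp only: times_complex.sel Re_complex_of_real Im_complex_of_real mult_zero_left diff_zero)
    show "N (\<lambda>i. of_real c * y i) = c\<^sup>2 * N y"
      by (simp add: N_def norm_mult power_mult_distrib sum_distrib_left)
  qed
  have N0: "N y \<ge> 0" for y by (simp add: N_def sum_nonneg)
  have bound: "\<mu> * N y \<le> F y" for y
  proof (cases "N y = 0")
    case True
    then have "\<forall>i\<in>S. y i = 0" using fin by (simp add: N_def sum_nonneg_eq_0_iff)
    then show ?thesis by (simp add: True F_def)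
  next
    case False
    then have pos: "N y > 0" using N0[of y] by simp
    define c where "c = 1 / sqrt (N y)"
    have c: "c\<^sup>2 * N y = 1" using pos by (simp add: c_def power_divide)
    \<comment> \<open>The normalised \<open>y\<close>, set to zero outside \<open>S\<close> to lie
      in \<open>K\<close>; \<open>F\<close> and \<open>N\<close> read only coordinates in
      \<open>S\<close>.\<close>
    define w where "w i = (if i \<in> S then of_real c * y i else 0)" for i
    have w: "F w = c\<^sup>2 * F y" "N w = 1"
      using scale[of c y] c by (simp_all add: F_def N_def w_def)
    have "cmod (w i) \<le> 1" if "i \<in> S" for i
    proof -
      have "(cmod (w i))\<^sup>2 \<le> N w" unfolding N_def using fin that by (intro member_le_sum) auto
      then show ?thesis using w by (simp add: power_le_one_iff abs_square_le_1)
    qed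
    then have "w \<in> K" using w by (auto simp: K_def B_def w_def)
    then have "\<mu> \<le> c\<^sup>2 * F y" using x(2)[of w] w(1) by (simp add: \<mu>_def)
    then have "\<mu> * N y \<le> (c\<^sup>2 * F y) * N y" using pos by (intro mult_right_mono) auto
    also have "\<dots> = (c\<^sup>2 * N y) * F y" by simp
    finally show ?thesis using c by simp
  qed
  have x1: "N x = 1" using x by (simp add: K_def)
  \<comment> \<open>The residual of the eigenvalue equation, to be shown zero on
    \<open>S\<close>.\<close>
  define r where "r i = (\<Sum>j\<in>S. Q i j * x j) - of_real \<mu> * x i" for i
  text \<open>The first variation of \<open>F - \<mu> N\<close> at \<open>x\<close> in the direction of the residual \<open>r\<close>.\<close>
  have expand: "F (\<lambda>i. x i + of_real t * r i) - \<mu> * N (\<lambda>i. x i + of_real t * r i)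
      = 2 * t * N r + t\<^sup>2 * (F r - \<mu> * N r)" for t :: real
  proof -
    \<comment> \<open>\<open>P\<close> and \<open>I\<close> are the sesquilinear forms polarising
      \<open>F\<close> and \<open>N\<close>.\<close>
    define P where "P u v = (\<Sum>i\<in>S. \<Sum>j\<in>S. cnj (u i) * Q i j * v j)" for u v :: "'a \<Rightarrow> complex"
    define I where "I u v = (\<Sum>i\<in>S. cnj (u i) * v i)" for u v :: "'a \<Rightarrow> complex"
    have FP: "F u = Re (P u u)" and NI: "N u = Re (I u u)" for u
      by (simp_all add: F_def P_def N_def I_def cmod_power2 flip: power2_eq_square)
    have P: "P (\<lambda>i. x i + of_real t * r i) (\<lambda>i. x i + of_real t * r i)
        = P x x + of_real t * (P x r + P r x) + of_real (t\<^sup>2) * P r r"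
      unfolding P_def sum_distrib_left sum.distrib[symmetric]
      by (intro sum.cong refl) (simp add: algebra_simps power2_eq_square)
    have I: "I (\<lambda>i. x i + of_real t * r i) (\<lambda>i. x i + of_real t * r i)
        = I x x + of_real t * (I x r + I r x) + of_real (t\<^sup>2) * I r r"
      unfolding I_def sum_distrib_left sum.distrib[symmetric]
      by (intro sum.cong refl) (simp add: algebra_simps power2_eq_square)
    have cnjQ: "Q j i = cnj (Q i j)" if "i \<in> S" "j \<in> S" for i j
      using herm that unfolding hermitian_on_def by blast
    have "cnj (P r x) = (\<Sum>i\<in>S. \<Sum>j\<in>S. cnj (x j) * Q j i * r i)"
      unfolding P_def cnj_sum by (intro sum.cong refl) (simp add: cnjQ[symmetric] mult_ac)
    also have "\<dots> = P x r" unfolding P_def by (rule sum.swap)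
    finally have Pc: "P x r = cnj (P r x)" ..
    have Ic: "I x r = cnj (I r x)" by (simp add: I_def mult_ac)
    \<comment> \<open>Substitutes \<open>Q x = r + \<mu> x\<close> on \<open>S\<close>; the
      \<open>\<mu>\<close> term cancels against the variation of \<open>\<mu> N\<close>, leaving
      \<open>2 * t * N r\<close>.\<close>
    have "P r x = I r r + of_real \<mu> * I r x"
    proof -
      have "P r x = (\<Sum>i\<in>S. cnj (r i) * (\<Sum>j\<in>S. Q i j * x j))"
        by (simp add: P_def sum_distrib_left mult.assoc)
      also have "\<dots> = (\<Sum>i\<in>S. cnj (r i) * (r i + of_real \<mu> * x i))"
        unfolding r_def by simp
      also have "\<dots> = I r r + of_real \<mu> * I r x"
        unfolding I_def sum_distrib_left sum.distrib[symmetric]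
        by (intro sum.cong refl) (simp add: algebra_simps)
      finally show ?thesis .
    qed
    then have PI: "Re (P r x) = N r + \<mu> * Re (I r x)" by (simp add: NI)
    have "F (\<lambda>i. x i + of_real t * r i) = \<mu> + 2 * t * Re (P r x) + t\<^sup>2 * F r"
      by (simp add: FP P Pc \<mu>_def)
    moreover have "N (\<lambda>i. x i + of_real t * r i) = 1 + 2 * t * Re (I r x) + t\<^sup>2 * N r"
      using x1 by (simp add: NI I Ic)
    ultimately show ?thesis
      by (simp add: PI algebra_simps)
  qed
  have "N r = 0"
  proof (rule ccontr)
    assume "N r \<noteq> 0"
    then have Nr: "N r > 0" using N0[of r] by simp
    define C where "C = F r - \<mu> * N r"
    have C: "C \<ge> 0" using bound[of r] by (simp add: C_def)
    have ge: "0 \<le> 2 * t * N r + t\<^sup>2 * C" for t :: real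
      using expand[of t] bound[of "\<lambda>i. x i + of_real t * r i"] by (simp add: C_def)
    \<comment> \<open>A negative \<open>t\<close> small enough for the linear term to dominate;
      \<open>C + 1\<close> keeps the denominator positive even when \<open>C = 0\<close>.\<close>
    define t where "t = - N r / (C + 1)"
    have t: "t < 0" "t * (C + 1) = - N r" using Nr C by (simp_all add: t_def divide_neg_pos)
    have "2 * t * N r + t\<^sup>2 * C = t * (2 * N r + (t * (C + 1) - t))"
      by (simp add: power2_eq_square algebra_simps)
    also have "\<dots> = t * (N r - t)" using t by simp
    also have "\<dots> < 0" using t Nr by (intro mult_neg_pos) auto
    finally show False using ge[of t] by simp
  qed
  then have "\<forall>i\<in>S. r i = 0" using fin by (simp add: N_def sum_nonneg_eq_0_iff)
  moreover have "\<exists>i\<in>S. x i \<noteq> 0"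
    using x1 unfolding N_def by (metis (mono_tags, lifting) norm_zero power_zero_numeral sum.neutral zero_neq_one)
  ultimately have "eigenvalue_on S Q (of_real \<mu>)"
    unfolding eigenvalue_on_def by (auto simp: r_def)
  then show ?thesis using bound unfolding F_def N_def by blast
qed

text \<open>The Rayleigh bound holds with some eigenvalue \<open>\<mu>\<close>, and the least
  eigenvalue is at most \<open>\<mu>\<close>, so the bound persists with it.\<close>

lemma min_eigenvalue_le_quadratic_form:
  assumes fin: "finite S" and "S \<noteq> {}" "hermitian_on S Q"
  shows "min_eigenvalue S Q * (\<Sum>i\<in>S. (cmod (x i))\<^sup>2)
    \<le> Re (\<Sum>i\<in>S. \<Sum>j\<in>S. cnj (x i) * Q i j * x j)"
proof -
  obtain \<mu> :: real where \<mu>: "eigenvalue_on S Q (of_real \<mu>)"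
    "\<And>x. \<mu> * (\<Sum>i\<in>S. (cmod (x i))\<^sup>2) \<le> Re (\<Sum>i\<in>S. \<Sum>j\<in>S. cnj (x i) * Q i j * x j)"
    using hermitian_rayleigh_bound[OF assms] by blast
  have "finite {k::real. eigenvalue_on S Q (of_real k)}"
    using finite_vimageI[OF finite_eigenvalues_on[OF fin, of Q] inj_of_real]
    by (simp add: vimage_def)
  then have "min_eigenvalue S Q \<le> \<mu>"
    unfolding min_eigenvalue_def using \<mu>(1) by (intro Min_le) auto
  then have "min_eigenvalue S Q * (\<Sum>i\<in>S. (cmod (x i))\<^sup>2) \<le> \<mu> * (\<Sum>i\<in>S. (cmod (x i))\<^sup>2)"
    by (intro mult_right_mono sum_nonneg) auto
  then show ?thesis using \<mu>(2)[of x] by linarith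
qed

section \<open>Combining the Fourier and Rayleigh bounds\<close>

theorem theorem3p5:
  fixes G :: "('a, 'm) monoid_scheme"
    and S :: "('a \<Rightarrow> complex) set"
    and f :: "'a \<Rightarrow> real"
    and Q :: "('a \<Rightarrow> complex) \<Rightarrow> ('a \<Rightarrow> complex) \<Rightarrow> complex"
  assumes "comm_group G" and "finite (carrier G)"
    and "S \<subseteq> characters G" and "S \<noteq> {}"
    and "hermitian_on S Q"
  shows "Min (f ` carrier G) \<ge> - fourier_l1_norm G (\<lambda>g. complex_of_real (f g) - quad_form S Q g)
           + min_eigenvalue S Q * real (card S)"
proof -
  interpret comm_group G by fact
  let ?e = "\<lambda>g. complex_of_real (f g) - quad_form S Q g"
  have finS: "finite S"
    using finite_characters assms(2,3) finite_subset by blast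
  have "- fourier_l1_norm G ?e + min_eigenvalue S Q * real (card S) \<le> f g"
    if g: "g \<in> carrier G" for g
  proof -
    \<comment> \<open>All coordinates of the vector of characters at \<open>g\<close> have modulus
      1.\<close>
    have "(\<Sum>\<chi>\<in>S. (cmod (\<chi> g))\<^sup>2) = real (card S)"
      using assms(2,3) g by (simp add: norm_character subset_iff)
    then have "min_eigenvalue S Q * real (card S) \<le> Re (quad_form S Q g)"
      using min_eigenvalue_le_quadratic_form[OF finS assms(4,5), of "\<lambda>\<chi>. \<chi> g"]
      by (simp add: quad_form_def)
    \<comment> \<open>Since \<open>f g\<close> is real, it is the sum of the real parts of
      \<open>?e g\<close> and \<open>quad_form S Q g\<close>.\<close>
    moreover have "- Re (?e g) \<le> fourier_l1_norm G ?e"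
      using norm_le_fourier_l1_norm[OF assms(2) g, of ?e] abs_Re_le_cmod[of "?e g"] by linarith
    ultimately show ?thesis by simp
  qed
  moreover have "carrier G \<noteq> {}" using one_closed by blast
  ultimately show ?thesis
    using assms(2) by simp
qed

end
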